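(* The following hold. (1) If $n\geq 2$ and $n=2^k3^l$ for some integers $k\geq 0$ and $l\geq 0$, then $diam(G_{WN}(\mathbb{Z}_n))=1$. (2) For a prime $p$, $diam(G_{WN}(\mathbb{Z}_p))=\frac{p-1}{2}$. (3) If $n=2p$, where $p\geq 5$ is an odd prime, then $diam(G_{WN}(\mathbb{Z}_n))=\frac{p-1}{2}$. (4) For a finite field $F$ of order $p^k$ (with $p$ prime, $k\geq 1$), $diam(G_{WN}(F))=\infty$ if and only if $k>1$.
   Context: $\mathbb{Z}_n$ is the ring of integers modulo $n$. For a ring $R$, $Idem(R)$ is the set of idempotents and $Nil(R)$ the set of nilpotent elements of $R$. An element $x\in R$ is weakly nil clean if $x=n+e$ or $x=n-e$ for some $e\in Idem(R)$ and $n\in Nil(R)$. The weakly nil clean graph $G_{WN}(R)$ is the simple undirected graph (no loops) with vertex set $R$, in which two distinct vertices $x,y$ are adjacent if and only if $x+y$ is a weakly nil clean element of $R$. The distance between two vertices is the number of edges on a shortest path between them ($\infty$ if there is no path), and the diameter $diam(G)$ of a graph $G$ is the maximum of the distances over all pairs of distinct vertices.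
   Formalization: Part (2) is stated for odd primes p only; for p = 2 the printed formula fails, since 0 and 1 are adjacent in Z_2, so the diameter is 1 and not 1/2 (the value 1 is covered by part (1)). *)

theory Defs
  imports
    "HOL-Algebra.Coset"
    "HOL-Algebra.Ring"
    "HOL-Number_Theory.Residues"
    "Graph_Theory.Shortest_Path"
begin

definition idem_elts :: "('a, 'm) ring_scheme \<Rightarrow> 'a set" where
  "idem_elts R = {e \<in> carrier R. e \<otimes>\<^bsub>R\<^esub> e = e}"

definition nil_elts :: "('a, 'm) ring_scheme \<Rightarrow> 'a set" where
  "nil_elts R = {a \<in> carrier R. \<exists>m::nat. m > 0 \<and> a [^]\<^bsub>R\<^esub> m = \<zero>\<^bsub>R\<^esub>}"

definition weakly_nil_clean :: "('a, 'm) ring_scheme \<Rightarrow> 'a \<Rightarrow> bool" where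
  "weakly_nil_clean R x \<longleftrightarrow>
     (\<exists>e \<in> idem_elts R. \<exists>a \<in> nil_elts R. x = a \<oplus>\<^bsub>R\<^esub> e \<or> x = a \<ominus>\<^bsub>R\<^esub> e)"

text \<open>
  A simple undirected graph is a loop-free digraph in which each edge \<open>{x, y}\<close> is
  represented by the two arcs \<open>(x, y)\<close> and \<open>(y, x)\<close>; this is the library's locale
  \<open>graph\<close>, see the lemma \<open>graph_G_WN\<close>.
\<close>

definition G_WN :: "('a, 'm) ring_scheme \<Rightarrow> ('a, 'a \<times> 'a) pre_digraph" where
  "G_WN R =
     \<lparr>verts = carrier R,
      arcs = {(x, y). x \<in> carrier R \<and> y \<in> carrier R \<and> x \<noteq> y \<and> weakly_nil_clean R (x \<oplus>\<^bsub>R\<^esub> y)},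
      tail = fst, head = snd\<rparr>"

text \<open>
  With unit weights, \<open>wf_digraph.\<mu>\<close> is the least number of arcs of a walk, and
  \<open>\<infinity>\<close> if there is none. The supremum below is a maximum for finite graphs with at
  least two vertices; for a graph with at most one vertex it is the supremum of the
  empty set, \<open>-\<infinity>\<close>.
\<close>

definition graph_dist :: "('a, 'b) pre_digraph \<Rightarrow> 'a \<Rightarrow> 'a \<Rightarrow> ereal" where
  "graph_dist G u v = wf_digraph.\<mu> G (\<lambda>_. 1) u v"

definition diam :: "('a, 'b) pre_digraph \<Rightarrow> ereal" where
  "diam G = Sup {graph_dist G u v | u v. u \<in> verts G \<and> v \<in> verts G \<and> u \<noteq> v}"

lemma (in ring) wf_digraph_G_WN: "wf_digraph (G_WN R)"
  by unfold_locales (auto simp: G_WN_def)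

lemma (in ring) graph_G_WN:
  assumes "finite (carrier R)"
  shows "graph (G_WN R)"
proof -
  have "arcs (G_WN R) \<subseteq> carrier R \<times> carrier R"
    by (auto simp: G_WN_def)
  then have "finite (arcs (G_WN R))"
    using assms by (meson finite_SigmaI finite_subset)
  then show ?thesis
    using assms
    by unfold_locales
      (auto simp: G_WN_def arc_to_ends_def arcs_ends_def symmetric_def a_comm image_iff intro!: symI)
qed

end

theory Submission
  imports Defs
begin

text \<open>
  Everything rests on knowing which elements are weakly nil clean.

  Modulo \<open>2 ^ k * 3 ^ l\<close> all of them are: by the Chinese remainder theorem idempotents can be
  prescribed separately modulo \<open>2 ^ k\<close> and modulo \<open>3 ^ l\<close>, and every residue modulo 2 or modulo 3
  is \<open>0\<close>, \<open>1\<close> or \<open>-1\<close>, so that a suitable idempotent, with a suitable sign, agrees with the given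
  element modulo 6, that is, up to a nilpotent (\<open>weakly_nil_clean_mod_2_3_powers\<close>). The graph is
  complete.

  Modulo an odd prime \<open>p\<close>, and modulo \<open>2 * p\<close>, the weakly nil clean residues are those congruent
  to \<open>0\<close>, \<open>1\<close> or \<open>-1\<close> modulo \<open>p\<close>; the component modulo 2 is unrestricted
  (\<open>weakly_nil_clean_mod_prime\<close>). A step of a walk thus replaces \<open>x\<close> by \<open>- x + c\<close> with
  \<open>\<bar>c\<bar> \<le> 1\<close>, modulo \<open>p\<close>, and after \<open>k\<close> steps the walk is at \<open>(-1) ^ k * x + s\<close>, where every
  \<open>s\<close> with \<open>\<bar>s\<bar> \<le> k\<close> can be achieved and no other. Write \<open>p = 2 * h + 1\<close>. Every residue modulo
  \<open>p\<close> has a representative in \<open>[-h, h]\<close>, so \<open>h\<close> steps always suffice, and going from \<open>0\<close> to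
  \<open>h\<close> takes at least \<open>h\<close> steps because the sign does not affect \<open>0\<close>
  (\<open>diam_residue_of_weakly_nil_clean_mod\<close>).

  In a field the weakly nil clean elements are \<open>0\<close>, \<open>1\<close> and \<open>-1\<close>. All of them lie in the prime
  subfield, so no walk that starts there can leave it. It has \<open>p\<close> elements (\<open>prime_subfield\<close>), so
  the graph is disconnected if the field has more than \<open>p\<close> elements. In a field with exactly \<open>p\<close>
  elements every element is a sum of ones, and \<open>x\<close>, \<open>- x\<close>, \<open>x + 1\<close> is a walk, so the graph is
  connected.
\<close>

section \<open>Diameter and lengths of walks\<close>

lemma (in wf_digraph) awalk_cost_unit: "awalk_cost (\<lambda>_. 1) p = real (length p)"
  by (induction p) auto

lemma graph_dist_le_length:
  assumes "wf_digraph G" "pre_digraph.awalk G u p v"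
  shows "graph_dist G u v \<le> ereal (real (length p))"
proof -
  interpret wf_digraph G by fact
  show ?thesis
    using min_cost_le_walk_cost[OF assms(2), of "\<lambda>_. 1"]
    by (simp add: graph_dist_def awalk_cost_unit)
qed

lemma graph_dist_ge:
  assumes "wf_digraph G" "\<And>p. pre_digraph.awalk G u p v \<Longrightarrow> d \<le> ereal (real (length p))"
  shows "d \<le> graph_dist G u v"
proof -
  interpret wf_digraph G by fact
  show ?thesis
    using assms(2) unfolding graph_dist_def \<mu>_def by (auto simp: awalk_cost_unit intro!: INF_greatest)
qed

text \<open>
  The least element of a set of walk lengths is bounded from above by one walk and from below by
  all of them, so for the value of the diameter a bound on walks between all pairs and a single pair
  at the full distance suffice.
\<close>

lemma diam_eqI:
  assumes G: "wf_digraph G"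
    and le: "\<And>u v. u \<in> verts G \<Longrightarrow> v \<in> verts G \<Longrightarrow> u \<noteq> v \<Longrightarrow>
               \<exists>p. pre_digraph.awalk G u p v \<and> length p \<le> d"
    and uv: "u \<in> verts G" "v \<in> verts G" "u \<noteq> v"
    and ge: "\<And>p. pre_digraph.awalk G u p v \<Longrightarrow> d \<le> length p"
  shows "diam G = ereal (real d)"
proof (rule antisym)
  show "diam G \<le> ereal (real d)"
    unfolding diam_def
  proof (rule Sup_least, clarify)
    fix x y assume xy: "x \<in> verts G" "y \<in> verts G" "x \<noteq> y"
    obtain p where p: "pre_digraph.awalk G x p y" "length p \<le> d"
      using le[OF xy] by blast
    have "graph_dist G x y \<le> ereal (real (length p))"
      using graph_dist_le_length[OF G p(1)] .
    also have "\<dots> \<le> ereal (real d)" using p(2) by simp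
    finally show "graph_dist G x y \<le> ereal (real d)" .
  qed
  have "ereal (real d) \<le> graph_dist G u v"
    using ge by (intro graph_dist_ge[OF G]) simp
  also have "\<dots> \<le> diam G" unfolding diam_def using uv by (blast intro: Sup_upper)
  finally show "ereal (real d) \<le> diam G" .
qed

lemma diam_complete:
  assumes G: "wf_digraph G"
    and adj: "\<And>u v. u \<in> verts G \<Longrightarrow> v \<in> verts G \<Longrightarrow> u \<noteq> v \<Longrightarrow>
                \<exists>e \<in> arcs G. tail G e = u \<and> head G e = v"
    and uv: "u \<in> verts G" "v \<in> verts G" "u \<noteq> v"
  shows "diam G = 1"
proof -
  interpret wf_digraph G by fact
  have "diam G = ereal (real 1)"
  proof (rule diam_eqI[OF G _ uv])
    fix x y assume xy: "x \<in> verts G" "y \<in> verts G" "x \<noteq> y"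
    then obtain e where "e \<in> arcs G" "tail G e = x" "head G e = y" using adj by blast
    then have "awalk x [e] y" by (auto simp: awalk_simps)
    then show "\<exists>p. awalk x p y \<and> length p \<le> 1" by fastforce
  next
    fix p assume "awalk u p v"
    then show "1 \<le> length p" using uv(3) by (cases p) (auto simp: awalk_Nil_iff)
  qed
  then show ?thesis by (simp add: one_ereal_def)
qed

text \<open>
  Connectedness only makes each single distance finite; the finiteness of the graph turns the
  supremum into a maximum.
\<close>

lemma diam_connected_finite:
  assumes G: "wf_digraph G" and fin: "finite (verts G)"
    and conn: "\<And>u v. u \<in> verts G \<Longrightarrow> v \<in> verts G \<Longrightarrow> \<exists>p. pre_digraph.awalk G u p v"
  shows "diam G \<noteq> \<infinity>"
proof -
  interpret wf_digraph G by fact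
  let ?D = "(\<lambda>(u, v). graph_dist G u v) ` {(u, v). u \<in> verts G \<and> v \<in> verts G \<and> u \<noteq> v}"
  have D: "diam G = Sup ?D"
    unfolding diam_def by (rule arg_cong[of _ _ Sup]) (auto simp: image_iff)
  have fin': "finite {(u, v). u \<in> verts G \<and> v \<in> verts G \<and> u \<noteq> v}"
    by (rule finite_subset[of _ "verts G \<times> verts G"]) (use fin in auto)
  have "d < \<infinity>" if d: "d \<in> ?D" for d
  proof -
    obtain u v where uv: "u \<in> verts G" "v \<in> verts G" "d = graph_dist G u v" using d by auto
    then obtain p where "awalk u p v" using conn by blast
    from graph_dist_le_length[OF G this] uv(3) show ?thesis by (auto intro: le_less_trans)
  qed
  have "Sup ?D < \<infinity>"
  proof (cases "?D = {}")
    case True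
    \<comment> \<open>with a single vertex the supremum is that of the empty set, which is \<open>-\<infinity>\<close>\<close>
    show ?thesis unfolding True by (simp add: bot_ereal_def)
  next
    case False
    have "finite ?D" using fin' by (rule finite_imageI)
    then have "Max ?D \<in> ?D" "Max ?D = Sup ?D" using False by (rule Max_in, rule Max_Sup)
    then have "Sup ?D \<in> ?D" by (simp only:)
    then show ?thesis using \<open>\<And>d. d \<in> ?D \<Longrightarrow> d < \<infinity>\<close> by blast
  qed
  then show ?thesis using D by simp
qed

lemma G_WN_simps [simp]:
  "verts (G_WN R) = carrier R" "tail (G_WN R) = fst" "head (G_WN R) = snd"
  "(x, y) \<in> arcs (G_WN R) \<longleftrightarrow>
     x \<in> carrier R \<and> y \<in> carrier R \<and> x \<noteq> y \<and> weakly_nil_clean R (x \<oplus>\<^bsub>R\<^esub> y)"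
  by (auto simp: G_WN_def)

lemma (in ring) awalk_G_WN_Cons:
  "pre_digraph.awalk (G_WN R) u (e # p) v \<longleftrightarrow>
     u \<in> carrier R \<and> snd e \<in> carrier R \<and> fst e = u \<and> u \<noteq> snd e \<and>
     weakly_nil_clean R (u \<oplus> snd e) \<and> pre_digraph.awalk (G_WN R) (snd e) p v"
proof -
  interpret wf_digraph "G_WN R" by (rule wf_digraph_G_WN)
  show ?thesis by (cases e) (auto simp: awalk_Cons_iff)
qed

section \<open>Weakly nil clean residues\<close>

context residues
begin

lemma cong_pow: "(x mod m) [^] (k::nat) = x ^ k mod m"
proof (induction k)
  case 0 then show ?case using m_gt_one by (simp add: res_one_eq)
next
  case (Suc k)
  then show ?case by (simp add: mult_cong mult.commute)
qed

text \<open>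
  This moves the question from the residue ring to divisibility of integers: the witnesses \<open>e\<close> and
  \<open>a\<close> may be any representatives of the idempotent and of the nilpotent residue.
\<close>

lemma weakly_nil_clean_residue_iff:
  assumes x: "x \<in> {0..m-1}"
  shows "weakly_nil_clean R x \<longleftrightarrow>
    (\<exists>e a. \<exists>k::nat. k > 0 \<and> m dvd e * (e - 1) \<and> m dvd a ^ k \<and> (m dvd x - (a + e) \<or> m dvd x - (a - e)))"
    (is "?L \<longleftrightarrow> ?R")
proof
  assume ?L
  then obtain e a k where h: "e \<in> carrier R" "e \<otimes> e = e" "a \<in> carrier R" "(k::nat) > 0"
    "a [^] k = \<zero>" "x = a \<oplus> e \<or> x = a \<ominus> e"
    by (auto simp: weakly_nil_clean_def idem_elts_def nil_elts_def)
  have "(e * e) mod m = e mod m"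
    using h(1,2) by (auto simp: res_mult_eq res_carrier_eq)
  then have "m dvd e * (e - 1)"
    by (simp add: mod_eq_dvd_iff algebra_simps)
  moreover have "m dvd a ^ k"
    using cong_pow[of a k] h(3,5) by (auto simp: res_carrier_eq res_zero_eq)
  moreover have "m dvd x - (a + e) \<or> m dvd x - (a - e)"
    using h(6)
  proof
    assume "x = a \<oplus> e"
    then have "x mod m = (a + e) mod m" by (simp add: res_add_eq)
    then show ?thesis by (simp add: mod_eq_dvd_iff)
  next
    assume "x = a \<ominus> e"
    then have "x mod m = (a - e) mod m" by (simp add: a_minus_def res_add_eq res_neg_eq mod_simps)
    then show ?thesis by (simp add: mod_eq_dvd_iff)
  qed
  ultimately show ?R using h(4) by blast
next
  assume ?R
  then obtain e a k where h: "(k::nat) > 0" "m dvd e * (e - 1)" "m dvd a ^ k"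
    "m dvd x - (a + e) \<or> m dvd x - (a - e)" by blast
  have "(e * e) mod m = e mod m" using h(2) by (simp add: mod_eq_dvd_iff algebra_simps)
  then have e: "e mod m \<in> idem_elts R"
    by (simp add: idem_elts_def mult_cong)
  have a: "a mod m \<in> nil_elts R"
    using h(1,3) by (auto simp: nil_elts_def cong_pow res_zero_eq)
  have x': "x = x mod m" using x by auto
  have "x = (a mod m) \<oplus> (e mod m) \<or> x = (a mod m) \<ominus> (e mod m)"
    using h(4)
  proof
    assume "m dvd x - (a + e)"
    then have "x mod m = (a + e) mod m" by (simp add: mod_eq_dvd_iff)
    then show ?thesis using x' by (simp add: add_cong)
  next
    assume "m dvd x - (a - e)"
    then have "x mod m = (a - e) mod m" by (simp add: mod_eq_dvd_iff)
    then show ?thesis using x' by (simp add: a_minus_def res_add_eq res_neg_eq mod_simps)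
  qed
  then show ?L using e a by (auto simp: weakly_nil_clean_def)
qed

end

text \<open>
  The idempotent \<open>e\<close> is chosen as \<open>x mod 2\<close> modulo \<open>2 ^ k\<close> and as \<open>x\<^sup>2 mod 3\<close> modulo
  \<open>3 ^ l\<close>; both are 0 or 1. The sign is dictated by 3 alone, as signs are invisible
  modulo 2. If \<open>k\<close> or \<open>l\<close> is 0, the corresponding congruence says nothing about \<open>e\<close>, but
  then the divisibility required of the power is trivial as well.
\<close>

lemma weakly_nil_clean_mod_2_3_powers:
  fixes x :: int and k l :: nat
  obtains e a where "2 ^ k * 3 ^ l dvd e * (e - 1)" "2 ^ k * 3 ^ l dvd a ^ (k + l + 1)"
    "a = x - e \<or> a = x + e"
proof -
  have cop: "coprime ((2::int) ^ k) (3 ^ l)" by simp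
  \<comment> \<open>\<open>x\<close> is congruent to \<open>s\<close> times an element of \<open>{0, 1}\<close> modulo 3\<close>
  define s :: int where "s = (if x mod 3 = 2 then -1 else 1)"
  obtain e where e: "[e = x mod 2] (mod 2 ^ k)" "[e = x\<^sup>2 mod 3] (mod 3 ^ l)"
    using binary_chinese_remainder_int[OF cop] by blast
  have "x mod 3 = 0 \<or> x mod 3 = 1 \<or> x mod 3 = 2" by presburger
  then have x3: "x\<^sup>2 mod 3 = s * (x mod 3) mod 3" "x\<^sup>2 mod 3 \<in> {0, 1}"
    using power_mod[of x 3 2] by (auto simp: s_def)
  have "[e * (e - 1) = 0] (mod 2 ^ k)"
  proof -
    have "[e * (e - 1) = (x mod 2) * (x mod 2 - 1)] (mod 2 ^ k)"
      by (intro cong_mult cong_diff e) auto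
    moreover have "(x mod 2) * (x mod 2 - 1) = 0" by (cases "even x") (auto simp: odd_iff_mod_2_eq_one)
    ultimately show ?thesis by simp
  qed
  moreover have "[e * (e - 1) = 0] (mod 3 ^ l)"
  proof -
    have "[e * (e - 1) = (x\<^sup>2 mod 3) * (x\<^sup>2 mod 3 - 1)] (mod 3 ^ l)"
      by (intro cong_mult cong_diff e) auto
    moreover have "(x\<^sup>2 mod 3) * (x\<^sup>2 mod 3 - 1) = 0" using x3(2) by auto
    ultimately show ?thesis by simp
  qed
  ultimately have 1: "2 ^ k * 3 ^ l dvd e * (e - 1)"
    using cop by (simp add: cong_0_iff divides_mult)
  have "2 ^ k dvd (x - s * e) ^ (k + l + 1)"
  proof (cases "k = 0")
    case False
    then have "[e = x mod 2] (mod 2)" using e(1) by (meson cong_dvd_modulus dvd_power zero_less_iff_neq_zero)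
    then have "2 dvd x - s * e" unfolding s_def cong_def by (simp split: if_splits; presburger)
    then have "2 ^ (k + l + 1) dvd (x - s * e) ^ (k + l + 1)" by (rule dvd_power_same)
    then show ?thesis by (rule dvd_trans[rotated]) (simp add: le_imp_power_dvd)
  qed auto
  moreover have "3 ^ l dvd (x - s * e) ^ (k + l + 1)"
  proof (cases "l = 0")
    case False
    then have "[e = x\<^sup>2 mod 3] (mod 3)" using e(2) by (meson cong_dvd_modulus dvd_power zero_less_iff_neq_zero)
    then have "e mod 3 = s * (x mod 3) mod 3" using x3(1) by (simp add: cong_def)
    then have "3 dvd x - s * e" unfolding s_def by (simp split: if_splits; presburger)
    then have "3 ^ (k + l + 1) dvd (x - s * e) ^ (k + l + 1)" by (rule dvd_power_same)
    then show ?thesis by (rule dvd_trans[rotated]) (simp add: le_imp_power_dvd)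
  qed auto
  ultimately have 2: "2 ^ k * 3 ^ l dvd (x - s * e) ^ (k + l + 1)"
    using cop by (simp add: divides_mult)
  show ?thesis
    by (rule that[OF 1 2]) (simp add: s_def)
qed

lemma diam_residue_2_3_powers:
  fixes n k l :: nat
  assumes n: "n \<ge> 2" "n = 2 ^ k * 3 ^ l"
  shows "diam (G_WN (residue_ring (int n))) = 1"
proof -
  interpret residues "int n" "residue_ring (int n)" by unfold_locales (use n(1) in auto)
  have wnc: "weakly_nil_clean (residue_ring (int n)) x" if x: "x \<in> {0..int n - 1}" for x
  proof -
    have n': "int n = 2 ^ k * 3 ^ l" using n(2) by simp
    obtain e a where ea: "int n dvd e * (e - 1)" "int n dvd a ^ (k + l + 1)" "a = x - e \<or> a = x + e"
      using weakly_nil_clean_mod_2_3_powers[of k l x] unfolding n' by blast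
    then have "int n dvd x - (a + e) \<or> int n dvd x - (a - e)" by auto
    with ea show ?thesis
      unfolding weakly_nil_clean_residue_iff[OF x]
      by (intro exI[of _ e] exI[of _ a] exI[of _ "k + l + 1"]) simp
  qed
  show ?thesis
  proof (rule diam_complete[OF wf_digraph_G_WN, of 0 1])
    fix u v assume "u \<in> verts (G_WN (residue_ring (int n)))" "v \<in> verts (G_WN (residue_ring (int n)))" "u \<noteq> v"
    then have "(u, v) \<in> arcs (G_WN (residue_ring (int n)))"
      using wnc a_closed by (auto simp: res_carrier_eq)
    then show "\<exists>e\<in>arcs (G_WN (residue_ring (int n))). tail (G_WN (residue_ring (int n))) e = u \<and>
        head (G_WN (residue_ring (int n))) e = v"
      by (intro bexI[of _ "(u, v)"]) auto
  qed (use n(1) in \<open>auto simp: res_carrier_eq\<close>)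
qed

section \<open>Adjacency modulo an odd prime\<close>

context residues
begin

text \<open>
  Each step negates the current residue and adds an error of at most 1; the later negations only
  change the signs of these errors, so their total is at most the number of steps.
\<close>

lemma awalk_end_cong:
  fixes p :: int
  assumes p: "p dvd m"
    and wnc: "\<And>x. x \<in> {0..m-1} \<Longrightarrow> weakly_nil_clean R x \<Longrightarrow> \<exists>c. \<bar>c\<bar> \<le> 1 \<and> [x = c] (mod p)"
    and w: "pre_digraph.awalk (G_WN R) x w y"
  shows "\<exists>s. \<bar>s\<bar> \<le> int (length w) \<and> [y = (-1) ^ length w * x + s] (mod p)"
  using w
proof (induction w arbitrary: x)
  case Nil
  interpret G: wf_digraph "G_WN R" by (rule wf_digraph_G_WN)
  show ?case using Nil by (auto simp: G.awalk_Nil_iff)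
next
  case (Cons e w)
  define z where "z = snd e"
  have c: "x \<in> carrier R" "z \<in> carrier R" "weakly_nil_clean R (x \<oplus> z)"
    "pre_digraph.awalk (G_WN R) z w y"
    using Cons.prems by (auto simp: awalk_G_WN_Cons z_def)
  obtain s where s: "\<bar>s\<bar> \<le> int (length w)" "[y = (-1) ^ length w * z + s] (mod p)"
    using Cons.IH[OF c(4)] by blast
  have "x \<oplus> z \<in> {0..m-1}" using c(1,2) a_closed res_carrier_eq by blast
  then obtain c where c': "\<bar>c\<bar> \<le> 1" "[x \<oplus> z = c] (mod p)" using wnc c(3) by blast
  have "[x + z = c] (mod p)" using c'(2) p by (simp add: res_add_eq cong_def mod_mod_cancel)
  then have "[z = c - x] (mod p)" by (simp add: cong_iff_dvd_diff algebra_simps)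
  then have "[(-1) ^ length w * z + s = (-1) ^ length w * (c - x) + s] (mod p)"
    by (intro cong_add cong_mult cong_refl)
  with s(2) have "[y = (-1) ^ length w * (c - x) + s] (mod p)" by (rule cong_trans)
  then have "[y = (-1) ^ length (e # w) * x + (s + (-1) ^ length w * c)] (mod p)"
    by (simp add: algebra_simps)
  moreover have "\<bar>s + (-1) ^ length w * c\<bar> \<le> int (length (e # w))"
  proof -
    have "\<bar>(-1) ^ length w * c\<bar> \<le> 1" using c'(1) by (simp add: abs_mult power_abs)
    then show ?thesis using s(1) by auto
  qed
  ultimately show ?case by blast
qed

text \<open>
  Conversely, the first step can absorb a unit of the offset \<open>s\<close>. Whenever two consecutive vertices
  of the walk constructed in this way coincide there is no arc, but the step can be left out; this is
  why the length is only bounded. The bound \<open>k \<ge> 1\<close> cannot be dropped, because \<open>p\<close> need not be the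
  modulus: for \<open>k = 0\<close> the vertices \<open>x\<close> and \<open>y\<close> are congruent modulo \<open>p\<close>, but may be distinct.
  With at least one step, the last one may end in any vertex of the prescribed class.
\<close>

lemma awalk_of_cong:
  fixes p :: int
  assumes p: "p dvd m"
    and wnc: "\<And>x c. x \<in> {0..m-1} \<Longrightarrow> \<bar>c\<bar> \<le> 1 \<Longrightarrow> [x = c] (mod p) \<Longrightarrow> weakly_nil_clean R x"
    and k: "k \<ge> 1" and x: "x \<in> carrier R" and y: "y \<in> carrier R"
    and s: "\<bar>s\<bar> \<le> int k" "[y = (-1) ^ k * x + s] (mod p)"
  shows "\<exists>w. pre_digraph.awalk (G_WN R) x w y \<and> length w \<le> k"
proof -
  interpret G: wf_digraph "G_WN R" by (rule wf_digraph_G_WN)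
  have step: "\<exists>w'. G.awalk u w' y \<and> length w' \<le> Suc (length w)"
    if u: "u \<in> carrier R" and c: "\<bar>c\<bar> \<le> 1" "[u + v = c] (mod p)" and w: "G.awalk v w y" for u v w c
  proof (cases "u = v")
    case True
    then show ?thesis using w le_SucI by blast
  next
    case False
    have v: "v \<in> carrier R" using G.awalk_hd_in_verts[OF w] by simp
    have "[u \<oplus> v = c] (mod p)" using c(2) p by (simp add: res_add_eq cong_def mod_mod_cancel)
    moreover have "u \<oplus> v \<in> {0..m-1}" using a_closed[OF u v] by (simp add: res_carrier_eq)
    ultimately have "weakly_nil_clean R (u \<oplus> v)" using wnc c(1) by blast
    then have "G.awalk u ((u, v) # w) y" using u v w False by (simp add: awalk_G_WN_Cons)
    then show ?thesis by force
  qed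
  have nil: "G.awalk y [] y" using y by (simp add: G.awalk_Nil_iff)
  show ?thesis
    using k x s
  proof (induction k arbitrary: x s rule: nat_induct_at_least)
    case base
    have "[x + y = s] (mod p)" using base by (simp add: cong_iff_dvd_diff algebra_simps)
    with step[OF _ _ _ nil, of x s] base show ?case by simp
  next
    case (Suc k)
    \<comment> \<open>the remaining \<open>k\<close> steps multiply the error \<open>c\<close> of the first one by \<open>(-1) ^ k\<close>,
      so this choice moves \<open>s\<close> towards 0\<close>
    define c where "c = (-1) ^ k * sgn s"
    define z where "z = (c - x) mod m"
    have z: "z \<in> carrier R" by (simp add: z_def)
    have c: "\<bar>c\<bar> \<le> 1" by (simp add: c_def abs_mult power_abs abs_sgn_eq)
    have zc: "[z = c - x] (mod p)" using p by (simp add: z_def cong_def mod_mod_cancel)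
    have sc: "(-1) ^ k * c = sgn s" by (simp add: c_def flip: mult.assoc power_mult_distrib)
    have "[(-1) ^ k * z + (s - sgn s) = (-1) ^ k * (c - x) + (s - sgn s)] (mod p)"
      by (intro cong_add cong_mult cong_refl zc)
    also have "(-1) ^ k * (c - x) + (s - sgn s) = (-1) ^ Suc k * x + s"
      using sc by (simp add: algebra_simps)
    finally have "[y = (-1) ^ k * z + (s - sgn s)] (mod p)"
      using Suc.prems(3) by (meson cong_sym cong_trans)
    moreover have "\<bar>s - sgn s\<bar> \<le> int k"
      using Suc.prems(2) Suc.hyps by (cases s "0::int" rule: linorder_cases) auto
    ultimately obtain w where w: "G.awalk z w y" "length w \<le> k"
      using Suc.IH[OF z] by blast
    have "[x + z = c] (mod p)" using zc by (simp add: cong_iff_dvd_diff algebra_simps)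
    from step[OF Suc.prems(1) c this w(1)] w(2) show ?case by fastforce
  qed
qed

text \<open>
  The pair \<open>0\<close>, \<open>h\<close> is extremal: walks from \<open>0\<close> of length \<open>k\<close> end in \<open>[-k, k]\<close> modulo \<open>p\<close>
  whatever the parity of \<open>k\<close>, and \<open>h\<close> is as far from \<open>0\<close> as a residue modulo \<open>2 * h + 1\<close> can be.
\<close>

lemma diam_residue_of_weakly_nil_clean_mod:
  fixes h :: nat and p :: int
  assumes h: "h \<ge> 1" and p: "p = 2 * int h + 1" "p dvd m"
    and wnc: "\<And>x. x \<in> {0..m-1} \<Longrightarrow> weakly_nil_clean R x \<longleftrightarrow> (\<exists>c. \<bar>c\<bar> \<le> 1 \<and> [x = c] (mod p))"
  shows "diam (G_WN R) = ereal (real h)"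
proof (rule diam_eqI[OF wf_digraph_G_WN, where u = 0 and v = "int h"])
  have "p \<le> m" using p(2) m_gt_one by (intro zdvd_imp_le) auto
  then show "0 \<in> verts (G_WN R)" "int h \<in> verts (G_WN R)" "0 \<noteq> int h"
    using h p(1) by (auto simp: res_carrier_eq)
next
  fix x y assume xy: "x \<in> verts (G_WN R)" "y \<in> verts (G_WN R)"
  \<comment> \<open>the representative of \<open>y - (-1) ^ h * x\<close> of least absolute value\<close>
  define s where "s = (y - (-1) ^ h * x + int h) mod p - int h"
  have "p > 0" using p(1) by simp
  then have "0 \<le> (y - (-1) ^ h * x + int h) mod p" "(y - (-1) ^ h * x + int h) mod p < p"
    by (rule pos_mod_sign, rule pos_mod_bound)
  then have "\<bar>s\<bar> \<le> int h" unfolding s_def using p(1) by linarith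
  moreover have "[y = (-1) ^ h * x + s] (mod p)"
  proof -
    have "y - ((-1) ^ h * x + s) = (y - (-1) ^ h * x + int h) - (y - (-1) ^ h * x + int h) mod p"
      by (simp add: s_def)
    then show ?thesis unfolding cong_iff_dvd_diff by (simp only: dvd_minus_mod)
  qed
  ultimately show "\<exists>w. pre_digraph.awalk (G_WN R) x w y \<and> length w \<le> h"
    using awalk_of_cong[OF p(2) _ h, of x y s] wnc xy by auto
next
  fix w assume w: "pre_digraph.awalk (G_WN R) 0 w (int h)"
  obtain s where s: "\<bar>s\<bar> \<le> int (length w)" "[int h = s] (mod p)"
    using awalk_end_cong[OF p(2) _ w] wnc by auto
  show "h \<le> length w"
  proof (rule ccontr)
    assume "\<not> h \<le> length w"
    then have "0 < int h - s" "int h - s < p" using s(1) p(1) by linarith+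
    moreover have "p dvd int h - s" using s(2) by (simp add: cong_iff_dvd_diff)
    ultimately show False using zdvd_imp_le by fastforce
  qed
qed

text \<open>
  Idempotents are 0 or 1 and nilpotents are 0 modulo \<open>p\<close>, which gives one direction. For the other
  no nilpotent is needed: if \<open>x\<close> is congruent to \<open>0\<close>, \<open>1\<close> or \<open>-1\<close> modulo \<open>p\<close>, then \<open>x\<close> or
  \<open>- x\<close> is itself idempotent, modulo \<open>2 * p\<close> too since every residue modulo 2 is idempotent.
\<close>

lemma weakly_nil_clean_mod_prime:
  fixes p :: int
  assumes p: "prime p" and m: "m = p \<or> m = 2 * p \<and> odd p" and x: "x \<in> {0..m-1}"
  shows "weakly_nil_clean R x \<longleftrightarrow> (\<exists>c. \<bar>c\<bar> \<le> 1 \<and> [x = c] (mod p))"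
proof
  assume "weakly_nil_clean R x"
  then obtain e a k where h: "(k::nat) > 0" "m dvd e * (e - 1)" "m dvd a ^ k"
    "m dvd x - (a + e) \<or> m dvd x - (a - e)"
    unfolding weakly_nil_clean_residue_iff[OF x] by blast
  have pm: "p dvd m" using m by auto
  have a: "p dvd a" using h(3) pm p by (meson dvd_trans prime_dvd_power)
  have e: "p dvd e \<or> p dvd e - 1" using h(2) pm p by (meson dvd_trans prime_dvd_multD)
  obtain t :: int where t: "\<bar>t\<bar> = 1" "p dvd x - (a + t * e)"
  proof (cases "m dvd x - (a + e)")
    case True
    then show ?thesis using pm that[of 1] by (auto intro: dvd_trans)
  next
    case False
    then show ?thesis using h(4) pm that[of "-1"] by (auto intro: dvd_trans)
  qed
  show "\<exists>c. \<bar>c\<bar> \<le> 1 \<and> [x = c] (mod p)"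
    using e
  proof
    assume "p dvd e"
    then have "p dvd (x - (a + t * e)) + (a + t * e)" using a t(2) by (intro dvd_add dvd_mult)
    then have "[x = 0] (mod p)" by (simp add: cong_0_iff)
    then show ?thesis by force
  next
    assume "p dvd e - 1"
    then have "p dvd (x - (a + t * e)) + (a + t * (e - 1))" using a t(2) by (intro dvd_add dvd_mult)
    then have "[x = t] (mod p)" by (simp add: cong_iff_dvd_diff algebra_simps)
    then show ?thesis using t(1) by force
  qed
next
  assume "\<exists>c. \<bar>c\<bar> \<le> 1 \<and> [x = c] (mod p)"
  then obtain c where c: "\<bar>c\<bar> \<le> 1" "p dvd x - c" by (auto simp: cong_iff_dvd_diff)
  define t :: int where "t = (if c = -1 then -1 else 1)"
  have "c = -1 \<or> c = 0 \<or> c = 1" using c(1) by linarith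
  then have "t * x = x - c \<or> t * x - 1 = t * (x - c)" by (auto simp: t_def)
  then have "p dvd (t * x) * (t * x - 1)"
    using c(2) by (metis dvd_mult dvd_mult2)
  moreover have "2 dvd (t * x) * (t * x - 1)" by (cases "even (t * x)") (simp_all add: dvd_mult dvd_mult2)
  ultimately have "m dvd (t * x) * (t * x - 1)"
    using m by (auto intro!: divides_mult simp: coprime_left_2_iff_odd)
  moreover have "m dvd x - (0 + t * x) \<or> m dvd x - (0 - t * x)"
    by (simp add: t_def)
  ultimately show "weakly_nil_clean R x"
    unfolding weakly_nil_clean_residue_iff[OF x]
    by (intro exI[of _ "t * x"] exI[of _ 0] exI[of _ 1]) auto
qed

end

lemma diam_residue_odd_prime:
  fixes p n :: nat
  assumes p: "prime p" "odd p" and n: "n = p \<or> n = 2 * p"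
  shows "diam (G_WN (residue_ring (int n))) = ereal ((real p - 1) / 2)"
proof -
  have p3: "p \<ge> 3" using p prime_ge_2_nat[of p] by (cases "p = 2") auto
  interpret residues "int n" "residue_ring (int n)" by unfold_locales (use n p3 in auto)
  obtain h where h: "p = 2 * h + 1" using p(2) by (rule oddE)
  have "diam (G_WN (residue_ring (int n))) = ereal (real h)"
  proof (rule diam_residue_of_weakly_nil_clean_mod[where p = "int p"])
    show "weakly_nil_clean (residue_ring (int n)) x \<longleftrightarrow> (\<exists>c. \<bar>c\<bar> \<le> 1 \<and> [x = c] (mod int p))"
      if "x \<in> {0..int n - 1}" for x
      by (rule weakly_nil_clean_mod_prime) (use p n that in auto)
    show "int p dvd int n" using n by auto
  qed (use h p3 in auto)
  also have "real h = (real p - 1) / 2" using h by simp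
  finally show ?thesis .
qed

section \<open>Finite fields\<close>

context field
begin

text \<open>
  In a domain, \<open>p ^ k\<close> times the unit is the \<open>k\<close>-th power of \<open>p\<close> times the unit, hence vanishes
  only if the latter does. So Lagrange's theorem, which gives the former, yields the characteristic.
\<close>

lemma add_pow_eq_zero_of_prime_power:
  assumes "[(p ^ k :: nat)] \<cdot> \<one> = \<zero>"
  shows "[p] \<cdot> \<one> = \<zero>"
  using assms
proof (induction k)
  case 0 then show ?case by simp
next
  case (Suc k)
  have "([p] \<cdot> \<one>) \<otimes> ([(p ^ k)] \<cdot> \<one>) = [p] \<cdot> ([(p ^ k)] \<cdot> \<one>)"
    by (simp add: add_pow_ldistr)
  also have "\<dots> = [(p ^ Suc k)] \<cdot> \<one>"
    by (simp add: add.nat_pow_pow mult.commute)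
  finally show ?case using Suc integral by fastforce
qed

text \<open>
  Additively, the prime subfield is the subgroup generated by the unit, whose order divides \<open>p\<close> and
  is not 1.
\<close>

lemma prime_subfield:
  assumes fin: "finite (carrier R)" and p: "Factorial_Ring.prime (p::nat)" and card: "Coset.order R = p ^ k"
  defines "P \<equiv> range (\<lambda>i::nat. [i] \<cdot> \<one>)"
  shows "subgroup P (add_monoid R)" "Finite_Set.card P = p"
proof -
  have gen: "P = generate (add_monoid R) {\<one>}"
    using add.generate_pow_on_finite_carrier[of \<one>] fin by (auto simp: P_def)
  show "subgroup P (add_monoid R)"
    unfolding gen by (rule add.generate_is_subgroup) simp
  have "[(Coset.order (add_monoid R))] \<cdot> \<one> = \<zero>"
    using add.pow_order_eq_1[of \<one>] by simp
  then have "[p] \<cdot> \<one> = \<zero>"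
    using card by (intro add_pow_eq_zero_of_prime_power[of p k]) (simp add: Coset.order_def)
  then have "add.ord \<one> dvd p" using add.pow_eq_id[of \<one> p] by simp
  moreover have "add.ord \<one> \<noteq> 1" using add.ord_eq_1[of \<one>] by simp
  ultimately have "add.ord \<one> = p" using p by (auto simp: prime_nat_iff)
  then show "Finite_Set.card P = p"
    unfolding gen using add.generate_pow_card[of \<one>] by simp
qed

lemma weakly_nil_clean_field_iff:
  "weakly_nil_clean R x \<longleftrightarrow> x \<in> {\<zero>, \<one>, \<ominus> \<one>}"
proof -
  have "a = \<zero>" if "a \<in> carrier R" "a [^] k = \<zero>" for a and k :: nat
    using that by (induction k) (auto dest: integral)
  moreover have "\<zero> [^] (1::nat) = \<zero>" by simp
  ultimately have nil: "nil_elts R = {\<zero>}"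
    unfolding nil_elts_def by (blast intro: zero_less_one zero_closed)
  have "e = \<one>" if "e \<in> carrier R" "e \<otimes> e = e" "e \<noteq> \<zero>" for e
    using m_lcancel[of e e \<one>] that by simp
  then have idem: "idem_elts R = {\<zero>, \<one>}" by (auto simp: idem_elts_def)
  show ?thesis by (auto simp: weakly_nil_clean_def nil idem a_minus_def)
qed

text \<open>
  The component of \<open>0\<close> is the prime subfield, so everything depends on whether it is the whole
  field.
\<close>

lemma diam_field_infinite_iff:
  assumes fin: "finite (carrier R)" and p: "Factorial_Ring.prime (p::nat)" and k: "k \<ge> 1"
    and card: "Coset.order R = p ^ k"
  shows "diam (G_WN R) = \<infinity> \<longleftrightarrow> k > 1"
proof -
  interpret G: wf_digraph "G_WN R" by (rule wf_digraph_G_WN)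
  define P where "P = range (\<lambda>i::nat. [i] \<cdot> \<one>)"
  note PP = prime_subfield[OF fin p card, folded P_def]
  interpret P: subgroup P "add_monoid R" by (rule PP(1))
  have P1: "\<zero> \<in> P" "\<one> \<in> P" 
    using P.one_closed by (auto simp: P_def intro!: image_eqI[of _ _ "1::nat"])
  show ?thesis
  proof (cases "k = 1")
    case True
    have PR: "P = carrier R"
      using P.subset PP(2) card True fin by (intro card_subset_eq) (auto simp: Coset.order_def)
    have reach_step: "x \<rightarrow>\<^sup>*\<^bsub>G_WN R\<^esub> y"
      if "x \<in> carrier R" "y \<in> carrier R" "x \<oplus> y \<in> {\<zero>, \<one>}" for x y
    proof (cases "x = y")
      case False
      then have "G.awalk x [(x, y)] y"
        using that by (auto simp: weakly_nil_clean_field_iff awalk_G_WN_Cons G.awalk_Nil_iff)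
      then show ?thesis by (rule G.reachable_awalkI)
    qed (use that in auto)
    \<comment> \<open>\<open>x\<close>, \<open>- x\<close>, \<open>x + 1\<close> are consecutive vertices, up to repetitions\<close>
    have reach: "x \<rightarrow>\<^sup>*\<^bsub>G_WN R\<^esub> (x \<oplus> [i] \<cdot> \<one>)" if x: "x \<in> carrier R" for x and i :: nat
    proof (induction i)
      case 0
      then show ?case using x by simp
    next
      case (Suc i)
      define y where "y = x \<oplus> [i] \<cdot> \<one>"
      have y: "y \<in> carrier R" using x by (simp add: y_def)
      have eq: "x \<oplus> [(Suc i)] \<cdot> \<one> = y \<oplus> \<one>" using x by (simp add: y_def a_assoc)
      have "y \<rightarrow>\<^sup>*\<^bsub>G_WN R\<^esub> (\<ominus> y)" using y by (intro reach_step) (auto simp: r_neg)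
      also have "(\<ominus> y) \<rightarrow>\<^sup>*\<^bsub>G_WN R\<^esub> (y \<oplus> \<one>)"
        using y by (intro reach_step) (auto simp: r_neg1 l_neg simp flip: a_assoc)
      finally show ?case unfolding eq using Suc.IH y_def G.reachable_trans by blast
    qed
    have "diam (G_WN R) \<noteq> \<infinity>"
    proof (rule diam_connected_finite[OF wf_digraph_G_WN])
      fix x y assume "x \<in> verts (G_WN R)" "y \<in> verts (G_WN R)"
      then have xy: "x \<in> carrier R" "y \<in> carrier R" by auto
      then have "\<ominus> x \<oplus> y \<in> P" by (simp add: PR)
      then obtain i :: nat where i: "\<ominus> x \<oplus> y = [i] \<cdot> \<one>" by (auto simp: P_def)
      have "y = x \<oplus> (\<ominus> x \<oplus> y)" using xy by (simp add: r_neg l_neg flip: a_assoc)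
      then show "\<exists>w. G.awalk x w y" using reach[OF xy(1), of i] i by (simp add: G.reachable_awalk)
    qed (use fin in auto)
    then show ?thesis using True by simp
  next
    case False
    then have k1: "k > 1" using k by simp
    have stay: "v \<in> P" if "G.awalk u w v" "u \<in> P" for u v w
      using that
    proof (induction w arbitrary: u)
      case Nil
      then show ?case by (simp add: G.awalk_Nil_iff)
    next
      case (Cons e w)
      define z where "z = snd e"
      have z: "u \<in> carrier R" "z \<in> carrier R" "u \<oplus> z \<in> {\<zero>, \<one>, \<ominus> \<one>}" "G.awalk z w v"
        using Cons.prems by (auto simp: awalk_G_WN_Cons z_def weakly_nil_clean_field_iff)
      have neg: "\<ominus> a \<in> P" if "a \<in> P" for a using P.m_inv_closed[OF that] by (simp add: a_inv_def)
      have "{\<zero>, \<one>, \<ominus> \<one>} \<subseteq> P" using P1 neg[OF P1(2)] by simp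
      then have "u \<oplus> z \<in> P" using z(3) by (rule subsetD)
      then have "\<ominus> u \<oplus> (u \<oplus> z) \<in> P" using P.m_closed[OF neg[OF Cons.prems(2)]] by simp
      then have "z \<in> P" using z(1,2) by (simp add: r_neg1)
      then show ?case by (rule Cons.IH[OF z(4)])
    qed
    have "p < p ^ k" using k1 prime_gt_1_nat[OF p] power_strict_increasing[of 1 k p] by simp
    then have "P \<noteq> carrier R" using PP(2) card by (auto simp: Coset.order_def)
    then obtain v where v: "v \<in> carrier R" "v \<notin> P" using P.subset by auto
    have "\<infinity> \<le> graph_dist (G_WN R) \<zero> v"
      using stay v(2) P1 by (intro graph_dist_ge[OF wf_digraph_G_WN]) blast
    also have "\<dots> \<le> diam (G_WN R)"
      unfolding diam_def using v P1 by (intro Sup_upper) auto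
    finally show ?thesis using k1 by simp
  qed
qed

end

section \<open>Diameters of weakly nil clean graphs\<close>

theorem theorem3p11:
  shows "(\<forall>n k l :: nat. n \<ge> 2 \<longrightarrow> n = 2 ^ k * 3 ^ l \<longrightarrow>
            diam (G_WN (residue_ring (int n))) = 1) \<and>
         (\<forall>p :: nat. prime p \<longrightarrow> odd p \<longrightarrow>
            diam (G_WN (residue_ring (int p))) = ereal ((real p - 1) / 2)) \<and>
         (\<forall>n p :: nat. prime p \<longrightarrow> odd p \<longrightarrow> p \<ge> 5 \<longrightarrow> n = 2 * p \<longrightarrow>
            diam (G_WN (residue_ring (int n))) = ereal ((real p - 1) / 2)) \<and>
         (\<forall>(F :: ('a, 'm) ring_scheme) (p :: nat) (k :: nat).
            field F \<longrightarrow> finite (carrier F) \<longrightarrow> prime p \<longrightarrow> k \<ge> 1 \<longrightarrow> order F = p ^ k \<longrightarrow>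
            (diam (G_WN F) = \<infinity> \<longleftrightarrow> k > 1))"
  using diam_residue_2_3_powers diam_residue_odd_prime field.diam_field_infinite_iff
  by blast

end
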